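(* Let $(\mathcal{X},\mathcal{B}(\mathcal{X}))$ be a measurable space, $\mathcal{P}$ the family of all nondegenerate probability measures on it, $\Theta$ a parameter space, $G$ a group of measurable transformations of $\mathcal{X}$ onto itself, and $H_G=\{h_g : g\in G\}$ the induced group of transformations $h_g:\Theta\to\Theta$. Let $D$ be any pseudometric on $\Theta$ such that $$\sup_{\theta_1,\theta_2\in\Theta} D(\theta_1,\theta_2)=\infty ,$$ and assume that the set $$G_1=\Big\{g\in G:\ \lim_{m\to\infty}\inf_{\theta\in\Theta} D(\theta,h_{g^m}(\theta))=\infty\Big\}$$ is nonempty. Then for every $G$-equivariant functional $T:\mathcal{P}\to\Theta$ and every sample $\mathbf{x}_n=(x_1,\ldots,x_n)$ of size $n$ of points of $\mathcal{X}$ whose empirical distribution $P_n=\frac1n\sum_{i=1}^n\delta_{x_i}$ belongs to $\mathcal{P}$, $$\mathrm{fsbp}(T,\mathbf{x}_n,D)\le \frac{1}{n}\left\lfloor\frac{n-n\Delta(P_n)+1}{2}\right\rfloor .$$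
   Context: For $P\in\mathcal{P}$ and $g\in G$, the measure $P^g$ is defined by $P^g(B)=P(g^{-1}(B))$ for $B\in\mathcal{B}(\mathcal{X})$. The unit element of $G$ (the identity transformation) is denoted $\iota$, and $g^m$ denotes the $m$-fold composition of $g$ with itself. The group $G$ induces a group $H_G=\{h_g:g\in G\}$ of transformations of $\Theta$. A functional $T:\mathcal{P}\to\Theta$ is called $G$-equivariant if $T(P^g)=h_g(T(P))$ for all $g\in G$ and all $P\in\mathcal{P}$. For a set $B\in\mathcal{B}(\mathcal{X})$, $g_{|B}$ denotes the restriction of $g$ to $B$, and $$\Delta(P)=\sup\{P(B):\ B\in\mathcal{B}(\mathcal{X}),\ g_{|B}=\iota_{|B}\ \text{for some } g\in G_1\}.$$ The finite-sample (replacement) breakdown point of $T$ at the sample $\mathbf{x}_n$ is $$\mathrm{fsbp}(T,\mathbf{x}_n,D)=\frac1n\min\Big\{k\in\{1,\ldots,n\}:\ \sup_{Q_{n,k}} D(T(P_n),T(Q_{n,k}))=\infty\Big\},$$ where $Q_{n,k}$ ranges over the empirical distributions, belonging to $\mathcal{P}$, of samples $\mathbf{y}_{n,k}$ of size $n$ of points of $\mathcal{X}$ obtained from $\mathbf{x}_n$ by altering at most $k$ of the $x_i$. Here $\delta_x$ denotes the point mass at $x$. *)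

theory Defs
  imports "HOL-Probability.Probability" "HOL-Algebra.Group_Action"
begin

text \<open>
  A measurable space is given by a measure \<open>X\<close>, of which only \<open>space X\<close> and \<open>sets X\<close> matter.
  The parameter space \<open>\<Theta>\<close> is a carrier set. Suprema and infima of distances, and the breakdown
  point, are taken in \<^typ>\<open>ereal\<close>, so that "\<open>= \<infinity>\<close>" is literal.
\<close>

text \<open>Nondegenerate means: not a point mass.\<close>
definition nondegenerate_measures :: "'a measure \<Rightarrow> 'a measure set" where
  "nondegenerate_measures X =
     {P. prob_space P \<and> sets P = sets X \<and> (\<forall>x\<in>space X. P \<noteq> return X x)}"

text \<open>
  Elements of \<^term>\<open>BijGroup S\<close> are extensional functions: they take the value \<^const>\<open>undefined\<close>
  outside \<open>S\<close>. As a subgroup is closed under inverses, all members of \<open>G\<close> are bimeasurable.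
\<close>
definition measurable_transformation_group :: "'a measure \<Rightarrow> ('a \<Rightarrow> 'a) set \<Rightarrow> bool" where
  "measurable_transformation_group X G \<longleftrightarrow>
     subgroup G (BijGroup (space X)) \<and> G \<subseteq> X \<rightarrow>\<^sub>M X"

text \<open>
  \<open>h\<close> is a homomorphism from \<open>G\<close> to the group of transformations of \<open>\<Theta>\<close>; the induced group
  \<open>H\<^sub>G\<close> is its image.
\<close>
definition induces_group ::
  "'a measure \<Rightarrow> ('a \<Rightarrow> 'a) set \<Rightarrow> 'b set \<Rightarrow> (('a \<Rightarrow> 'a) \<Rightarrow> 'b \<Rightarrow> 'b) \<Rightarrow> bool" where
  "induces_group X G \<Theta> h \<longleftrightarrow> group_action ((BijGroup (space X))\<lparr>carrier := G\<rparr>) \<Theta> h"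

definition pseudometric_on :: "'b set \<Rightarrow> ('b \<Rightarrow> 'b \<Rightarrow> real) \<Rightarrow> bool" where
  "pseudometric_on \<Theta> D \<longleftrightarrow>
     (\<forall>x\<in>\<Theta>. \<forall>y\<in>\<Theta>. D x y \<ge> 0) \<and>
     (\<forall>x\<in>\<Theta>. D x x = 0) \<and>
     (\<forall>x\<in>\<Theta>. \<forall>y\<in>\<Theta>. D x y = D y x) \<and>
     (\<forall>x\<in>\<Theta>. \<forall>y\<in>\<Theta>. \<forall>z\<in>\<Theta>. D x z \<le> D x y + D y z)"

definition G1 ::
  "'a measure \<Rightarrow> ('a \<Rightarrow> 'a) set \<Rightarrow> 'b set \<Rightarrow> (('a \<Rightarrow> 'a) \<Rightarrow> 'b \<Rightarrow> 'b) \<Rightarrow> ('b \<Rightarrow> 'b \<Rightarrow> real)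
    \<Rightarrow> ('a \<Rightarrow> 'a) set" where
  "G1 X G \<Theta> h D =
     {g\<in>G. (\<lambda>m::nat. INF \<theta>\<in>\<Theta>. ereal (D \<theta> (h (g [^]\<^bsub>BijGroup (space X)\<^esub> m) \<theta>)))
             \<longlonglongrightarrow> \<infinity>}"

text \<open>\<open>P\<^sup>g\<close> is \<^term>\<open>distr P X g\<close>.\<close>
definition equivariant ::
  "'a measure \<Rightarrow> ('a \<Rightarrow> 'a) set \<Rightarrow> (('a \<Rightarrow> 'a) \<Rightarrow> 'b \<Rightarrow> 'b) \<Rightarrow> ('a measure \<Rightarrow> 'b) \<Rightarrow> bool" where
  "equivariant X G h T \<longleftrightarrow>
     (\<forall>g\<in>G. \<forall>P\<in>nondegenerate_measures X. T (distr P X g) = h g (T P))"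

text \<open>
  The supremum is over a set that is bounded by 1, and nonempty whenever \<^const>\<open>G1\<close> is.
\<close>
definition Delta ::
  "'a measure \<Rightarrow> ('a \<Rightarrow> 'a) set \<Rightarrow> 'b set \<Rightarrow> (('a \<Rightarrow> 'a) \<Rightarrow> 'b \<Rightarrow> 'b) \<Rightarrow> ('b \<Rightarrow> 'b \<Rightarrow> real)
    \<Rightarrow> 'a measure \<Rightarrow> real" where
  "Delta X G \<Theta> h D P =
     Sup {measure P B | B. B \<in> sets X \<and>
            (\<exists>g\<in>G1 X G \<Theta> h D. restrict g B = restrict \<one>\<^bsub>BijGroup (space X)\<^esub> B)}"

definition empirical :: "'a measure \<Rightarrow> 'a list \<Rightarrow> 'a measure" where
  "empirical X xs =
     measure_of (space X) (sets X)
       (\<lambda>B. (\<Sum>i<length xs. emeasure (return X (xs ! i)) B) / of_nat (length xs))"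

lemma space_empirical [simp]: "space (empirical X xs) = space X"
  and sets_empirical [simp]: "sets (empirical X xs) = sets X"
  by (simp_all add: empirical_def)

lemma emeasure_empirical:
  assumes "B \<in> sets X"
  shows "emeasure (empirical X xs) B
           = (\<Sum>i<length xs. indicator B (xs ! i)) / of_nat (length xs)"
proof -
  let ?\<mu> = "\<lambda>B. (\<Sum>i<length xs. emeasure (return X (xs ! i)) B) / of_nat (length xs)"
  have "countably_additive (sets X) ?\<mu>"
  proof (rule countably_additiveI)
    fix A :: "nat \<Rightarrow> 'a set"
    assume A: "range A \<subseteq> sets X" "disjoint_family A"
    have "(\<Sum>j. ?\<mu> (A j))
            = (\<Sum>i<length xs. \<Sum>j. emeasure (return X (xs ! i)) (A j)) / of_nat (length xs)"
      by (simp only: ennreal_suminf_divide suminf_sum summableI)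
    also have "\<dots> = ?\<mu> (\<Union>j. A j)"
      using A by (subst suminf_emeasure) auto
    finally show "(\<Sum>j. ?\<mu> (A j)) = ?\<mu> (\<Union>j. A j)" .
  qed
  moreover have "positive (sets X) ?\<mu>"
    by (simp add: positive_def)
  ultimately have "emeasure (empirical X xs) B = ?\<mu> B"
    unfolding empirical_def
    using assms by (intro emeasure_measure_of_sigma sets.sigma_algebra_axioms)
  with assms show ?thesis
    by simp
qed

definition altered_samples :: "'a measure \<Rightarrow> 'a list \<Rightarrow> nat \<Rightarrow> 'a list set" where
  "altered_samples X xs k =
     {ys. length ys = length xs \<and> set ys \<subseteq> space X \<and>
          card {i. i < length xs \<and> ys ! i \<noteq> xs ! i} \<le> k}"

text \<open>
  The minimum is written as an infimum in \<^typ>\<open>ereal\<close>: it agrees with the minimum if some \<open>k\<close>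
  qualifies, and makes the breakdown point infinite (not \<open>0\<close>) if none does.
\<close>
definition fsbp ::
  "'a measure \<Rightarrow> ('a measure \<Rightarrow> 'b) \<Rightarrow> 'a list \<Rightarrow> ('b \<Rightarrow> 'b \<Rightarrow> real) \<Rightarrow> ereal" where
  "fsbp X T xs D =
     ereal (1 / real (length xs)) *
     (INF k\<in>{k\<in>{1..length xs}.
               (SUP Q\<in>{Q \<in> empirical X ` altered_samples X xs k. Q \<in> nondegenerate_measures X}.
                  ereal (D (T (empirical X xs)) (T Q))) = \<infinity>}.
        ereal (real k))"

end

theory Submission
  imports Defs
begin

text \<open>
  Let \<open>B\<close> attain \<open>\<Delta>(P\<^sub>n)\<close>, witnessed by \<open>g \<in> G\<^sub>1\<close>, and let \<open>B\<close> contain \<open>l\<close> of the sample points;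
  \<open>l < n\<close>, as otherwise \<open>T(P\<^sub>n)\<close> would be fixed by every \<open>h\<^bsub>g^m\<^esub>\<close>. Put \<open>k = \<lfloor>(n - l + 1) / 2\<rfloor>\<close> and
  split the points outside \<open>B\<close> into a set \<open>J\<close> of \<open>k\<close> points and a set \<open>K\<close> of at most \<open>k\<close> points.
  Applying \<open>g^m\<close> to the points of \<open>J\<close> and applying \<open>g^-m\<close> to the points of \<open>K\<close> gives two
  samples with empirical distributions \<open>Q\<close> and \<open>Q'\<close> such that \<open>Q\<close> is the image of \<open>Q'\<close> under \<open>g^m\<close>.
  Hence \<open>D(T(Q'), T(Q))\<close> tends to infinity with \<open>m\<close>, and by the triangle inequality \<open>T(Q)\<close> and
  \<open>T(Q')\<close> cannot both stay within bounded distance of \<open>T(P\<^sub>n)\<close>. The distribution \<open>Q\<close> may be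
  degenerate, but not for two consecutive values of \<open>m\<close>.
\<close>

section \<open>Points that measurable sets do not separate\<close>

text \<open>The sigma-algebra need not separate points, so \<open>return X x\<close> and
  \<open>return X y\<close> may coincide for distinct \<open>x\<close> and \<open>y\<close> in
  \<open>space X\<close>. This relation says exactly when they do, and thus replaces equality of
  sample points wherever degeneracy is at stake.\<close>

definition indistinguishable :: "'a measure \<Rightarrow> 'a \<Rightarrow> 'a \<Rightarrow> bool" where
  "indistinguishable X x y \<longleftrightarrow> (\<forall>A\<in>sets X. x \<in> A \<longleftrightarrow> y \<in> A)"

lemma indistinguishable_refl [simp]: "indistinguishable X x x"
  and indistinguishable_sym: "indistinguishable X x y \<Longrightarrow> indistinguishable X y x"
  and indistinguishable_trans:
    "indistinguishable X x y \<Longrightarrow> indistinguishable X y z \<Longrightarrow> indistinguishable X x z"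
  by (auto simp: indistinguishable_def)

lemma indistinguishable_image:
  assumes "f \<in> X \<rightarrow>\<^sub>M Y" "x \<in> space X" "y \<in> space X" "indistinguishable X x y"
  shows "indistinguishable Y (f x) (f y)"
  unfolding indistinguishable_def
proof
  fix A assume "A \<in> sets Y"
  then have "f -` A \<inter> space X \<in> sets X"
    using assms(1) by (rule measurable_sets[rotated])
  then have "x \<in> f -` A \<inter> space X \<longleftrightarrow> y \<in> f -` A \<inter> space X"
    using assms(4) unfolding indistinguishable_def by (rule bspec[rotated])
  then show "f x \<in> A \<longleftrightarrow> f y \<in> A"
    using assms(2,3) by simp
qed

section \<open>Empirical distributions: frequencies, images, nondegeneracy\<close>

lemma emeasure_empirical_card:
  assumes "B \<in> sets X" "xs \<noteq> []"
  shows "emeasure (empirical X xs) B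
           = ennreal (real (card {i. i < length xs \<and> xs ! i \<in> B}) / real (length xs))"
proof -
  have "(\<Sum>i<length xs. indicator B (xs ! i) :: ennreal)
          = (\<Sum>i<length xs. if xs ! i \<in> B then 1 else 0)"
    by (intro sum.cong) (auto simp: indicator_def)
  also have "\<dots> = of_nat (card ({..<length xs} \<inter> {i. xs ! i \<in> B}))"
    by (subst sum.If_cases) auto
  also have "{..<length xs} \<inter> {i. xs ! i \<in> B} = {i. i < length xs \<and> xs ! i \<in> B}"
    by auto
  finally show ?thesis
    using assms by (simp add: emeasure_empirical ennreal_of_nat_eq_real_of_nat divide_ennreal)
qed

lemma measure_empirical_card:
  assumes "B \<in> sets X" "xs \<noteq> []"
  shows "measure (empirical X xs) B
           = real (card {i. i < length xs \<and> xs ! i \<in> B}) / real (length xs)"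
  using emeasure_empirical_card[OF assms] by (simp add: measure_def)

lemma prob_space_empirical:
  assumes "set xs \<subseteq> space X" "xs \<noteq> []"
  shows "prob_space (empirical X xs)"
proof
  have "{i. i < length xs \<and> xs ! i \<in> space X} = {..<length xs}"
    using assms(1) nth_mem by auto
  then show "emeasure (empirical X xs) (space (empirical X xs)) = 1"
    using assms(2) by (simp add: emeasure_empirical_card)
qed

lemma distr_empirical:
  assumes "f \<in> X \<rightarrow>\<^sub>M X" "set ys \<subseteq> space X"
  shows "distr (empirical X ys) X f = empirical X (map f ys)"
proof (rule measure_eqI)
  fix A assume "A \<in> sets (distr (empirical X ys) X f)"
  then have A: "A \<in> sets X" by simp
  have f: "f \<in> empirical X ys \<rightarrow>\<^sub>M X"
    using assms(1) by (simp cong: measurable_cong_sets)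
  have "f -` A \<inter> space X \<in> sets X"
    using A assms(1) by (rule measurable_sets[rotated])
  moreover have "indicator (f -` A \<inter> space X) (ys ! i) = (indicator A (f (ys ! i)) :: ennreal)"
    if "i < length ys" for i
    using that assms(2) nth_mem by (auto simp: indicator_def)
  ultimately show "emeasure (distr (empirical X ys) X f) A = emeasure (empirical X (map f ys)) A"
    using A f by (simp add: emeasure_distr emeasure_empirical)
qed simp

text \<open>If no measurable set separates two sample points, every measurable set has mass 0 or 1,
  just as under the point mass at \<open>hd ys\<close>. A set that separates two of them has mass
  strictly between 0 and 1, which no point mass allows.\<close>

lemma empirical_nondegenerate_iff:
  assumes "set ys \<subseteq> space X" "ys \<noteq> []"
  shows "empirical X ys \<in> nondegenerate_measures X
           \<longleftrightarrow> (\<exists>x\<in>set ys. \<exists>y\<in>set ys. \<not> indistinguishable X x y)"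
proof
  assume nd: "empirical X ys \<in> nondegenerate_measures X"
  show "\<exists>x\<in>set ys. \<exists>y\<in>set ys. \<not> indistinguishable X x y"
  proof (rule ccontr)
    assume "\<not> ?thesis"
    then have all: "x \<in> A \<longleftrightarrow> hd ys \<in> A" if "x \<in> set ys" "A \<in> sets X" for x A
      using that assms(2) unfolding indistinguishable_def by (meson hd_in_set)
    have "empirical X ys = return X (hd ys)"
    proof (rule measure_eqI)
      fix A assume "A \<in> sets (empirical X ys)"
      then have A: "A \<in> sets X" by simp
      have "{i. i < length ys \<and> ys ! i \<in> A} = (if hd ys \<in> A then {..<length ys} else {})"
        using all[OF nth_mem A] by auto
      then show "emeasure (empirical X ys) A = emeasure (return X (hd ys)) A"
        using A assms(2) by (simp add: emeasure_empirical_card)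
    qed simp
    moreover have "hd ys \<in> space X"
      using assms hd_in_set by blast
    ultimately show False
      using nd by (auto simp: nondegenerate_measures_def)
  qed
next
  assume "\<exists>x\<in>set ys. \<exists>y\<in>set ys. \<not> indistinguishable X x y"
  then obtain x y A where xy: "x \<in> set ys" "y \<in> set ys" "A \<in> sets X" "(x \<in> A) \<noteq> (y \<in> A)"
    unfolding indistinguishable_def by blast
  let ?I = "{i. i < length ys \<and> ys ! i \<in> A}"
  have "empirical X ys \<noteq> return X z" if "z \<in> space X" for z
  proof
    assume "empirical X ys = return X z"
    then have "real (card ?I) / real (length ys) = indicator A z"
      using measure_empirical_card[OF xy(3) assms(2)] xy(3) by (simp add: measure_return)
    \<comment> \<open>A point mass takes only the values 0 and 1, so \<open>A\<close> contains all
      of the sample or none of it.\<close>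
    then have card: "card ?I = (if z \<in> A then card {..<length ys} else 0)"
      using assms(2) by (auto simp: indicator_def field_simps split: if_splits)
    have sub: "?I \<subseteq> {..<length ys}" "finite ?I"
      by auto
    have "?I = (if z \<in> A then {..<length ys} else {})"
    proof (cases "z \<in> A")
      case True
      then have "?I = {..<length ys}"
        using card sub(1) by (intro card_subset_eq) simp_all
      with True show ?thesis by simp
    next
      case False
      then show ?thesis
        using card sub(2) by simp
    qed
    then have "w \<in> A \<longleftrightarrow> z \<in> A" if "w \<in> set ys" for w
      using that by (auto simp: in_set_conv_nth split: if_splits)
    with xy show False by blast
  qed
  then show "empirical X ys \<in> nondegenerate_measures X"
    using prob_space_empirical[OF assms] by (auto simp: nondegenerate_measures_def)
qed

section \<open>Powers and inverses in the transformation group\<close>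

text \<open>Powers are defined with the new factor on the right; \<open>nat_pow_Suc2\<close> moves
  it to the left, so that \<open>g\<close> is applied last.\<close>

lemma BijGroup_pow_Suc_apply:
  assumes "g \<in> carrier (BijGroup S)" "x \<in> S"
  shows "(g [^]\<^bsub>BijGroup S\<^esub> Suc m) x = g ((g [^]\<^bsub>BijGroup S\<^esub> m) x)"
proof -
  interpret group "BijGroup S" by (rule group_BijGroup)
  have mult: "(a \<otimes>\<^bsub>BijGroup S\<^esub> b) x = a (b x)"
    if "a \<in> carrier (BijGroup S)" "b \<in> carrier (BijGroup S)" for a b
    using that assms(2) by (simp add: BijGroup_def compose_def)
  show ?thesis
    unfolding nat_pow_Suc2[OF assms(1)] using assms(1) nat_pow_closed[OF assms(1)] by (rule mult)
qed

lemma BijGroup_pow_fixes: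
  assumes "g \<in> carrier (BijGroup S)" "x \<in> S" "g x = x"
  shows "(g [^]\<^bsub>BijGroup S\<^esub> (m::nat)) x = x"
proof (induction m)
  case 0
  then show ?case using assms(2) by (simp add: nat_pow_def BijGroup_def)
next
  case (Suc m)
  then show ?case using assms by (simp only: BijGroup_pow_Suc_apply)
qed

lemma transformation_group_pow:
  assumes "measurable_transformation_group X G" "g \<in> G"
  shows "g [^]\<^bsub>BijGroup (space X)\<^esub> (m::nat) \<in> G"
proof -
  interpret subgroup G "BijGroup (space X)"
    using assms(1) by (simp add: measurable_transformation_group_def)
  interpret group "BijGroup (space X)" by (rule group_BijGroup)
  show ?thesis
    using assms(2) by (induction m) auto
qed

text \<open>The group inverse serves as \<open>u\<close>. Its membership in \<open>G\<close> is what
  makes it measurable, so that it can be applied to samples and cancelled from indistinguishable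
  points.\<close>

lemma transformation_group_inverse:
  assumes "measurable_transformation_group X G" "f \<in> G"
  obtains u where "u \<in> G" "\<And>x. x \<in> space X \<Longrightarrow> u (f x) = x" "\<And>x. x \<in> space X \<Longrightarrow> f (u x) = x"
proof -
  interpret subgroup G "BijGroup (space X)"
    using assms(1) by (simp add: measurable_transformation_group_def)
  interpret group "BijGroup (space X)" by (rule group_BijGroup)
  let ?u = "inv\<^bsub>BijGroup (space X)\<^esub> f"
  have u: "?u \<in> G" using assms(2) by (rule m_inv_closed)
  have "f \<in> Bij (space X)" "?u \<in> Bij (space X)"
    using assms(2) u subset by (auto simp: BijGroup_def)
  moreover have "?u \<otimes>\<^bsub>BijGroup (space X)\<^esub> f = \<one>\<^bsub>BijGroup (space X)\<^esub>"
    "f \<otimes>\<^bsub>BijGroup (space X)\<^esub> ?u = \<one>\<^bsub>BijGroup (space X)\<^esub>"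
    using assms(2) subset by auto
  ultimately have "compose (space X) ?u f = (\<lambda>x\<in>space X. x)"
    "compose (space X) f ?u = (\<lambda>x\<in>space X. x)"
    by (simp_all add: BijGroup_def)
  then show ?thesis
    using that[OF u] by (auto simp: compose_def fun_eq_iff split: if_splits)
qed

section \<open>The supremum \<Delta> is a maximum\<close>

text \<open>An empirical distribution of \<open>length xs\<close> points takes only values that are
  multiples of \<open>1 / length xs\<close> in the unit interval, so the supremum is over a finite
  set.\<close>

lemma Delta_attained:
  assumes "G1 X G \<Theta> h D \<noteq> {}" "xs \<noteq> []"
  obtains g B where "g \<in> G1 X G \<Theta> h D" "B \<in> sets X" "\<And>x. x \<in> B \<Longrightarrow> g x = x"
    "Delta X G \<Theta> h D (empirical X xs)
       = real (card {i. i < length xs \<and> xs ! i \<in> B}) / real (length xs)"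
proof -
  let ?S = "{measure (empirical X xs) B | B. B \<in> sets X \<and>
     (\<exists>g\<in>G1 X G \<Theta> h D. restrict g B = restrict \<one>\<^bsub>BijGroup (space X)\<^esub> B)}"
  have "?S \<subseteq> (\<lambda>k. real k / real (length xs)) ` {..length xs}"
  proof
    fix r assume "r \<in> ?S"
    then obtain B where B: "B \<in> sets X" "r = measure (empirical X xs) B" by blast
    have "card {i. i < length xs \<and> xs ! i \<in> B} \<le> card {..<length xs}"
      by (rule card_mono) auto
    then show "r \<in> (\<lambda>k. real k / real (length xs)) ` {..length xs}"
      using B assms(2) by (auto simp: measure_empirical_card)
  qed
  then have fin: "finite ?S"
    by (rule finite_subset) simp
  \<comment> \<open>Every \<open>g\<close> agrees with the identity on the empty set, so any member
    of \<open>G1\<close> shows that \<open>?S\<close> is nonempty.\<close>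
  have "measure (empirical X xs) {} \<in> ?S"
    using assms(1) by fastforce
  then have ne: "?S \<noteq> {}" by blast
  then have "Sup ?S \<in> ?S"
    using Max_in[OF fin ne] by (simp only: cSup_eq_Max[OF fin ne])
  then obtain B g where B: "B \<in> sets X" "g \<in> G1 X G \<Theta> h D"
    "restrict g B = restrict \<one>\<^bsub>BijGroup (space X)\<^esub> B" "Sup ?S = measure (empirical X xs) B"
    by blast
  have "g x = x" if "x \<in> B" for x
  proof -
    have "x \<in> space X" using that B(1) sets.sets_into_space by blast
    moreover have "g x = \<one>\<^bsub>BijGroup (space X)\<^esub> x"
      using fun_cong[OF B(3), of x] that by simp
    ultimately show ?thesis by (simp add: BijGroup_def)
  qed
  with B that show ?thesis
    using assms(2) by (simp add: Delta_def measure_empirical_card)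
qed

section \<open>Nondegeneracy of the altered samples\<close>

text \<open>
  If both were degenerate, then \<open>g^m x\<^sub>j \<sim> x\<^sub>i \<sim> g^(m+1) x\<^sub>j\<close> for \<open>j \<in> J\<close> up to indistinguishability, so
  \<open>g x\<^sub>i \<sim> x\<^sub>i\<close> and \<open>g^m x\<^sub>j \<sim> g^m x\<^sub>i\<close>; cancelling \<open>g^m\<close> makes the original sample degenerate.
\<close>
lemma altered_nondegenerate:
  assumes G: "measurable_transformation_group X G" and g: "g \<in> G"
    and xs: "set xs \<subseteq> space X" "empirical X xs \<in> nondegenerate_measures X" "xs \<noteq> []"
    and i: "i < length xs" "i \<notin> J"
  defines "ys \<equiv> \<lambda>m::nat. map (\<lambda>j. if j \<in> J then (g [^]\<^bsub>BijGroup (space X)\<^esub> m) (xs ! j) else xs ! j)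
                      [0..<length xs]"
  shows "empirical X (ys m) \<in> nondegenerate_measures X \<or>
         empirical X (ys (Suc m)) \<in> nondegenerate_measures X"
proof (rule ccontr)
  let ?p = "\<lambda>m::nat. g [^]\<^bsub>BijGroup (space X)\<^esub> m"
  let ?z = "xs ! i"
  let ?R = "indistinguishable X"
  assume neg: "\<not> ?thesis"
  have meas: "f \<in> X \<rightarrow>\<^sub>M X" if "f \<in> G" for f
    using G that by (auto simp: measurable_transformation_group_def)
  have car: "g \<in> carrier (BijGroup (space X))"
    using G g by (auto simp: measurable_transformation_group_def dest: subgroup.subset)
  have pG: "?p k \<in> G" for k
    using G g by (rule transformation_group_pow)
  have sp: "f x \<in> space X" if "f \<in> G" "x \<in> space X" for f x
    using meas[OF that(1)] that(2) by (rule measurable_space)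
  have xsp: "xs ! j \<in> space X" if "j < length xs" for j
    using xs(1) that nth_mem by blast
  have ysp: "set (ys k) \<subseteq> space X" for k
    using xsp sp pG by (auto simp: ys_def)
  have len: "ys k \<noteq> []" for k
    using xs(3) by (simp add: ys_def)
  \<comment> \<open>Since \<open>i\<close> is outside \<open>J\<close>, entry \<open>i\<close> is
    still \<open>?z\<close> in both samples; degeneracy then ties every other entry to
    \<open>?z\<close>.\<close>
  have R: "?R (ys k ! j) ?z" if "k = m \<or> k = Suc m" "j < length xs" for k j
  proof -
    have "empirical X (ys k) \<notin> nondegenerate_measures X"
      using that(1) neg by auto
    moreover have "ys k ! j \<in> set (ys k)" "ys k ! i \<in> set (ys k)"
      using that(2) i(1) by (simp_all only: ys_def nth_mem length_map length_upt diff_zero)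
    moreover have "ys k ! i = ?z"
      using i by (simp add: ys_def)
    ultimately show ?thesis
      using empirical_nondegenerate_iff[OF ysp len] by metis
  qed
  have "?R (xs ! j) ?z" if j: "j < length xs" for j
  proof (cases "j \<in> J")
    case False
    then show ?thesis using R[of m j] j by (simp add: ys_def)
  next
    case True
    have a: "?R (?p m (xs ! j)) ?z" "?R (?p (Suc m) (xs ! j)) ?z"
      using R[of m j] R[of "Suc m" j] j True by (simp_all add: ys_def)
    have "?R (g (?p m (xs ! j))) (g ?z)"
      using indistinguishable_image[OF meas[OF g] sp[OF pG xsp[OF j]] xsp[OF i(1)] a(1)] .
    then have gz: "?R (g ?z) ?z"
      using a(2) car xsp[OF j]
      by (metis BijGroup_pow_Suc_apply indistinguishable_sym indistinguishable_trans)
    have "?R (?p k ?z) ?z" for k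
    proof (induction k)
      case 0
      then show ?case using xsp[OF i(1)] by (simp add: nat_pow_def BijGroup_def)
    next
      case (Suc k)
      then have "?R (g (?p k ?z)) (g ?z)"
        using indistinguishable_image[OF meas[OF g] sp[OF pG xsp[OF i(1)]] xsp[OF i(1)]] by blast
      then show ?case
        using gz car xsp[OF i(1)] by (metis BijGroup_pow_Suc_apply indistinguishable_trans)
    qed
    then have b: "?R (?p m (xs ! j)) (?p m ?z)"
      using a(1) indistinguishable_sym indistinguishable_trans by metis
    obtain u where u: "u \<in> G" "\<And>x. x \<in> space X \<Longrightarrow> u (?p m x) = x"
      using transformation_group_inverse[OF G pG] by metis
    have "?R (u (?p m (xs ! j))) (u (?p m ?z))"
      using indistinguishable_image[OF meas[OF u(1)] sp[OF pG xsp[OF j]] sp[OF pG xsp[OF i(1)]] b] .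
    then show ?thesis
      using u(2) xsp i j by simp
  qed
  then have "?R x y" if "x \<in> set xs" "y \<in> set xs" for x y
    using that by (metis in_set_conv_nth indistinguishable_sym indistinguishable_trans)
  then show False
    using empirical_nondegenerate_iff[OF xs(1,3)] xs(2) by blast
qed

section \<open>Altered samples with unbounded distance\<close>

lemma SUP_ereal_not_infinity_bound:
  fixes f :: "'c \<Rightarrow> real"
  assumes "(SUP x\<in>A. ereal (f x)) \<noteq> \<infinity>"
  obtains C where "\<And>x. x \<in> A \<Longrightarrow> f x \<le> C"
proof -
  \<comment> \<open>If the supremum is -\<infinity>, as for empty \<open>A\<close>, any
    \<open>C\<close> will do.\<close>
  obtain C where C: "(SUP x\<in>A. ereal (f x)) \<le> ereal C"
    using assms by (cases "SUP x\<in>A. ereal (f x)") auto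
  show ?thesis
  proof
    fix x assume "x \<in> A"
    then have "ereal (f x) \<le> ereal C"
      using C by (meson SUP_upper order_trans)
    then show "f x \<le> C" by simp
  qed
qed

text \<open>The sets \<open>J\<close> and \<open>K\<close> are kept abstract: disjoint, of size at
  most \<open>k\<close>, and together containing every index whose point \<open>g\<close> moves. An
  index outside \<open>J\<close> supplies the unaltered point that
  \<open>altered_nondegenerate\<close> asks for.\<close>

lemma SUP_altered_eq_infinity:
  assumes G: "measurable_transformation_group X G"
    and D: "pseudometric_on \<Theta> D"
    and T: "T \<in> nondegenerate_measures X \<rightarrow> \<Theta>" "equivariant X G h T"
    and xs: "set xs \<subseteq> space X" "empirical X xs \<in> nondegenerate_measures X" "xs \<noteq> []"
    and g: "g \<in> G1 X G \<Theta> h D"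
    and J: "J \<subseteq> {..<length xs}" "card J \<le> k" "J \<noteq> {..<length xs}"
    and K: "K \<subseteq> {..<length xs}" "card K \<le> k" "J \<inter> K = {}"
    and fixed: "\<And>i. i < length xs \<Longrightarrow> i \<notin> J \<Longrightarrow> i \<notin> K \<Longrightarrow> g (xs ! i) = xs ! i"
  shows "(SUP Q\<in>{Q \<in> empirical X ` altered_samples X xs k. Q \<in> nondegenerate_measures X}.
            ereal (D (T (empirical X xs)) (T Q))) = \<infinity>"
proof (rule ccontr)
  let ?p = "\<lambda>m::nat. g [^]\<^bsub>BijGroup (space X)\<^esub> m"
  let ?A = "{Q \<in> empirical X ` altered_samples X xs k. Q \<in> nondegenerate_measures X}"
  let ?P = "empirical X xs"
  assume "\<not> ?thesis"
  then obtain C where C: "\<And>Q. Q \<in> ?A \<Longrightarrow> D (T ?P) (T Q) \<le> C"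
    using SUP_ereal_not_infinity_bound[of "\<lambda>Q. D (T ?P) (T Q)" ?A] by auto
  have gG: "g \<in> G" and lim: "(\<lambda>m. INF \<theta>\<in>\<Theta>. ereal (D \<theta> (h (?p m) \<theta>))) \<longlonglongrightarrow> \<infinity>"
    using g by (auto simp: G1_def)
  \<comment> \<open>If two values lie within \<open>C\<close> of \<open>T ?P\<close>, their distance
    is at most \<open>2 * C\<close>; large powers of \<open>g\<close> move every parameter farther
    than that.\<close>
  have "eventually (\<lambda>m. ereal (2 * C) < (INF \<theta>\<in>\<Theta>. ereal (D \<theta> (h (?p m) \<theta>)))) sequentially"
    using lim by (rule order_tendstoD) simp
  then obtain m0 where m0: "\<And>m. m \<ge> m0 \<Longrightarrow> ereal (2 * C) < (INF \<theta>\<in>\<Theta>. ereal (D \<theta> (h (?p m) \<theta>)))"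
    by (auto simp: eventually_sequentially)
  obtain i where i: "i < length xs" "i \<notin> J"
    using J by auto
  define ys where
    "ys = (\<lambda>m. map (\<lambda>j. if j \<in> J then ?p m (xs ! j) else xs ! j) [0..<length xs])"
  \<comment> \<open>Either \<open>m0\<close> or \<open>Suc m0\<close> serves, and both are past the
    threshold.\<close>
  obtain m where m: "m \<ge> m0" "empirical X (ys m) \<in> nondegenerate_measures X"
    using altered_nondegenerate[OF G gG xs i, of m0] unfolding ys_def by (meson le_refl le_SucI)
  have pG: "?p m \<in> G"
    using G gG by (rule transformation_group_pow)
  have meas: "f \<in> X \<rightarrow>\<^sub>M X" if "f \<in> G" for f
    using G that by (auto simp: measurable_transformation_group_def)
  have sp: "f x \<in> space X" if "f \<in> G" "x \<in> space X" for f x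
    using meas[OF that(1)] that(2) by (rule measurable_space)
  have car: "g \<in> carrier (BijGroup (space X))"
    using G gG by (auto simp: measurable_transformation_group_def dest: subgroup.subset)
  have xsp: "xs ! j \<in> space X" if "j < length xs" for j
    using xs(1) that nth_mem by blast
  obtain u where u: "u \<in> G" "\<And>x. x \<in> space X \<Longrightarrow> ?p m (u x) = x"
    using transformation_group_inverse[OF G pG] by metis
  define zs where "zs = map (\<lambda>j. if j \<in> K then u (xs ! j) else xs ! j) [0..<length xs]"
  have zsp: "set zs \<subseteq> space X" and ysp: "set (ys m) \<subseteq> space X"
    using xsp sp pG u(1) by (auto simp: zs_def ys_def)
  have ne: "zs \<noteq> []" "ys m \<noteq> []"
    using xs(3) by (auto simp: zs_def ys_def)
  \<comment> \<open>On \<open>J\<close> the entry of \<open>zs\<close> is the original one and gets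
    moved; on \<open>K\<close> the power undoes \<open>u\<close>; elsewhere \<open>g\<close>, hence
    its power, fixes the point. Disjointness of \<open>J\<close> and \<open>K\<close> keeps the
    first two cases apart.\<close>
  have map: "map (?p m) zs = ys m"
  proof (rule nth_equalityI)
    show "length (map (?p m) zs) = length (ys m)"
      by (simp add: zs_def ys_def)
    fix j assume "j < length (map (?p m) zs)"
    then have j: "j < length xs" by (simp add: zs_def)
    have "?p m (xs ! j) = xs ! j" if "j \<notin> J" "j \<notin> K"
      using car xsp[OF j] fixed[OF j that] by (rule BijGroup_pow_fixes)
    then show "map (?p m) zs ! j = ys m ! j"
      using j u(2)[OF xsp[OF j]] K(3) by (auto simp: zs_def ys_def)
  qed
  \<comment> \<open>Measurable maps preserve indistinguishability, so two separated entries of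
    \<open>ys m\<close> come from separated entries of \<open>zs\<close>.\<close>
  have zs_nd: "empirical X zs \<in> nondegenerate_measures X"
  proof -
    obtain x y where "x \<in> set (ys m)" "y \<in> set (ys m)" "\<not> indistinguishable X x y"
      using m(2) empirical_nondegenerate_iff[OF ysp ne(2)] by blast
    then obtain x' y' where "x' \<in> set zs" "y' \<in> set zs" "\<not> indistinguishable X (?p m x') (?p m y')"
      unfolding map[symmetric] by auto
    then show ?thesis
      using empirical_nondegenerate_iff[OF zsp ne(1)] zsp indistinguishable_image[OF meas[OF pG]]
      by blast
  qed
  \<comment> \<open>Only inclusions hold in general, because a transformation may leave a chosen
    point where it is; the bound on the number of changes needs no more.\<close>
  have "{j. j < length xs \<and> ys m ! j \<noteq> xs ! j} \<subseteq> J" "{j. j < length xs \<and> zs ! j \<noteq> xs ! j} \<subseteq> K"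
    by (auto simp: ys_def zs_def split: if_splits)
  moreover have "finite J" "finite K"
    using J(1) K(1) finite_subset by blast+
  ultimately have "card {j. j < length xs \<and> ys m ! j \<noteq> xs ! j} \<le> k"
    "card {j. j < length xs \<and> zs ! j \<noteq> xs ! j} \<le> k"
    using J(2) K(2) by (meson card_mono order_trans)+
  then have "ys m \<in> altered_samples X xs k" "zs \<in> altered_samples X xs k"
    using ysp zsp by (simp_all add: altered_samples_def) (simp_all add: ys_def zs_def)
  then have le: "D (T ?P) (T (empirical X (ys m))) \<le> C" "D (T ?P) (T (empirical X zs)) \<le> C"
    using C m(2) zs_nd by auto
  have \<Theta>: "T ?P \<in> \<Theta>" "T (empirical X (ys m)) \<in> \<Theta>" "T (empirical X zs) \<in> \<Theta>"
    using T(1) xs(2) m(2) zs_nd by auto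
  have "T (empirical X (ys m)) = h (?p m) (T (empirical X zs))"
    using T(2) pG zs_nd distr_empirical[OF meas[OF pG] zsp] unfolding equivariant_def map by metis
  then have "(INF \<theta>\<in>\<Theta>. ereal (D \<theta> (h (?p m) \<theta>)))
               \<le> ereal (D (T (empirical X zs)) (T (empirical X (ys m))))"
    using INF_lower[OF \<Theta>(3), of "\<lambda>\<theta>. ereal (D \<theta> (h (?p m) \<theta>))"] by simp
  then have "2 * C < D (T (empirical X zs)) (T (empirical X (ys m)))"
    using order_less_le_trans[OF m0[OF m(1)]] by fastforce
  moreover have "D (T (empirical X zs)) (T (empirical X (ys m)))
      \<le> D (T (empirical X zs)) (T ?P) + D (T ?P) (T (empirical X (ys m)))"
    "D (T (empirical X zs)) (T ?P) = D (T ?P) (T (empirical X zs))"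
    using D \<Theta> unfolding pseudometric_on_def by blast+
  ultimately show False
    using le by linarith
qed

text \<open>If \<open>g\<close> fixed the whole sample, each power of \<open>g\<close> would
  preserve the empirical distribution, and equivariance would make its parameter a fixed point of
  the induced map. The infimum in \<open>G1\<close> would then be at most 0 for every power, against
  its limit \<infinity>.\<close>

lemma G1_moves_sample:
  assumes G: "measurable_transformation_group X G"
    and D: "pseudometric_on \<Theta> D"
    and T: "T \<in> nondegenerate_measures X \<rightarrow> \<Theta>" "equivariant X G h T"
    and xs: "set xs \<subseteq> space X" "empirical X xs \<in> nondegenerate_measures X"
    and g: "g \<in> G1 X G \<Theta> h D"
  obtains x where "x \<in> set xs" "g x \<noteq> x"
proof -
  let ?p = "\<lambda>m::nat. g [^]\<^bsub>BijGroup (space X)\<^esub> m"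
  let ?\<theta> = "T (empirical X xs)"
  have "\<not> (\<forall>x\<in>set xs. g x = x)"
  proof
    assume fixed: "\<forall>x\<in>set xs. g x = x"
    have gG: "g \<in> G" and lim: "(\<lambda>m. INF \<theta>\<in>\<Theta>. ereal (D \<theta> (h (?p m) \<theta>))) \<longlonglongrightarrow> \<infinity>"
      using g by (auto simp: G1_def)
    have car: "g \<in> carrier (BijGroup (space X))"
      using G gG by (auto simp: measurable_transformation_group_def dest: subgroup.subset)
    have "eventually (\<lambda>m. 0 < (INF \<theta>\<in>\<Theta>. ereal (D \<theta> (h (?p m) \<theta>)))) sequentially"
      using lim by (rule order_tendstoD) simp
    then obtain m where m: "0 < (INF \<theta>\<in>\<Theta>. ereal (D \<theta> (h (?p m) \<theta>)))"
      by (auto simp: eventually_sequentially)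
    have pG: "?p m \<in> G"
      using G gG by (rule transformation_group_pow)
    then have "?p m \<in> X \<rightarrow>\<^sub>M X"
      using G by (auto simp: measurable_transformation_group_def)
    moreover have "map (?p m) xs = xs"
      using fixed xs(1) car by (intro map_idI) (auto intro!: BijGroup_pow_fixes)
    ultimately have "distr (empirical X xs) X (?p m) = empirical X xs"
      using xs(1) by (simp add: distr_empirical)
    then have "h (?p m) ?\<theta> = ?\<theta>"
      using T(2) pG xs(2) unfolding equivariant_def by metis
    moreover have "?\<theta> \<in> \<Theta>"
      using T(1) xs(2) by auto
    moreover have "D ?\<theta> ?\<theta> = 0"
      using D \<open>?\<theta> \<in> \<Theta>\<close> by (simp add: pseudometric_on_def)
    ultimately have "(INF \<theta>\<in>\<Theta>. ereal (D \<theta> (h (?p m) \<theta>))) \<le> 0"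
      using INF_lower[of ?\<theta> \<Theta> "\<lambda>\<theta>. ereal (D \<theta> (h (?p m) \<theta>))"]
      by (simp flip: zero_ereal_def)
    with m show False by simp
  qed
  with that show ?thesis by blast
qed

section \<open>Counting the sample points outside an optimal set\<close>

theorem theorem3p2:
  fixes X :: "'a measure"
    and G :: "('a \<Rightarrow> 'a) set"
    and \<Theta> :: "'b set"
    and h :: "('a \<Rightarrow> 'a) \<Rightarrow> 'b \<Rightarrow> 'b"
    and D :: "'b \<Rightarrow> 'b \<Rightarrow> real"
    and T :: "'a measure \<Rightarrow> 'b"
    and n :: nat
    and xs :: "'a list"
  assumes "measurable_transformation_group X G"
    and "induces_group X G \<Theta> h"
    and "pseudometric_on \<Theta> D"
    and "(SUP \<theta>\<^sub>1\<in>\<Theta>. SUP \<theta>\<^sub>2\<in>\<Theta>. ereal (D \<theta>\<^sub>1 \<theta>\<^sub>2)) = \<infinity>"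
    and "G1 X G \<Theta> h D \<noteq> {}"
    and "T \<in> nondegenerate_measures X \<rightarrow> \<Theta>"
    and "equivariant X G h T"
    and "length xs = n"
    and "set xs \<subseteq> space X"
    and "empirical X xs \<in> nondegenerate_measures X"
  shows "fsbp X T xs D
           \<le> ereal (1 / real n *
               of_int \<lfloor>(real n - real n * Delta X G \<Theta> h D (empirical X xs) + 1) / 2\<rfloor>)"
proof -
  \<comment> \<open>For the empty list the empirical measure is zero, hence not a probability
    measure.\<close>
  have ne: "xs \<noteq> []"
  proof
    assume "xs = []"
    then have "emeasure (empirical X xs) (space X) = 0"
      by (simp add: emeasure_empirical)
    moreover have "prob_space (empirical X xs)"
      using assms(10) by (simp add: nondegenerate_measures_def)
    ultimately show False
      using prob_space.emeasure_space_1 by fastforce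
  qed
  obtain g B where g: "g \<in> G1 X G \<Theta> h D" and fixed: "\<And>x. x \<in> B \<Longrightarrow> g x = x"
    and \<Delta>: "Delta X G \<Theta> h D (empirical X xs)
       = real (card {i. i < length xs \<and> xs ! i \<in> B}) / real (length xs)"
    using Delta_attained[OF assms(5) ne] by metis
  define l where "l = card {i. i < length xs \<and> xs ! i \<in> B}"
  define M where "M = {i. i < n \<and> xs ! i \<notin> B}"
  \<comment> \<open>This is half of \<open>n - l\<close> rounded up: the least \<open>k\<close> for
    which \<open>n - l\<close> indices split into two sets of size at most \<open>k\<close>.\<close>
  define k where "k = (n - l + 1) div 2"
  have "M = {..<n} - {i. i < length xs \<and> xs ! i \<in> B}"
    using assms(8) by (auto simp: M_def)
  then have cM: "card M = n - l"
    using card_Diff_subset[of "{i. i < length xs \<and> xs ! i \<in> B}" "{..<n}"] assms(8)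
    by (auto simp: l_def)
  have finM: "finite M" by (simp add: M_def)
  have "l \<le> card {..<n}"
    unfolding l_def using assms(8) by (intro card_mono) auto
  then have ln: "l \<le> n" by simp
  \<comment> \<open>A moved sample point lies outside \<open>B\<close>, which gives
    \<open>l < n\<close> and hence \<open>1 \<le> k\<close>, the lower end of the range in
    \<open>fsbp\<close>.\<close>
  obtain x where "x \<in> set xs" "g x \<noteq> x"
    using G1_moves_sample[OF assms(1,3,6,7,9,10) g] by metis
  then have "M \<noteq> {}"
    using fixed assms(8) by (force simp: M_def in_set_conv_nth)
  then have "card M \<noteq> 0"
    using finM by simp
  then have ln': "l < n" using cM by simp
  \<comment> \<open>With \<open>n = 1\<close> and \<open>l = 0\<close> one would get
    \<open>k = n\<close>, and no index would be left outside \<open>J\<close>. A single observation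
    has a degenerate empirical distribution, which excludes this.\<close>
  have n2: "n \<ge> 2"
  proof (rule ccontr)
    assume "\<not> n \<ge> 2"
    then obtain y where "xs = [y]"
      using assms(8) ne by (cases xs; cases "tl xs") auto
    then show False
      using assms(9,10) empirical_nondegenerate_iff[OF assms(9) ne] by simp
  qed
  have k: "1 \<le> k" "k \<le> n - l" "k < n" "n - l - k \<le> k" "k \<le> n"
    using ln' n2 unfolding k_def by auto
  obtain J where J: "J \<subseteq> M" "card J = k"
    using k(2) cM by (metis obtain_subset_with_card_n)
  have "card (M - J) = n - l - k"
    using J cM finM by (simp add: card_Diff_subset finite_subset)
  then have K: "card (M - J) \<le> k" using k(4) by simp
  have "J \<noteq> {..<length xs}"
    using J(2) k(3) assms(8) by auto
  then have "(SUP Q\<in>{Q \<in> empirical X ` altered_samples X xs k. Q \<in> nondegenerate_measures X}.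
            ereal (D (T (empirical X xs)) (T Q))) = \<infinity>"
    using J K fixed assms(8)
    by (intro SUP_altered_eq_infinity[OF assms(1,3,6,7,9,10) ne g, where J = J and K = "M - J"])
       (auto simp: M_def)
  \<comment> \<open>\<open>k\<close> belongs to the set of breaking counts, so the infimum is at
    most \<open>k\<close>.\<close>
  then have "fsbp X T xs D \<le> ereal (1 / real (length xs)) * ereal (real k)"
    unfolding fsbp_def using k assms(8) by (intro ereal_mult_left_mono INF_lower) auto
  \<comment> \<open>Since \<open>l \<le> n\<close>, the truncated difference agrees with the real
    one, and \<open>div\<close> on naturals is the floor of the real quotient.\<close>
  also have "real k = of_int \<lfloor>(real n - real n * Delta X G \<Theta> h D (empirical X xs) + 1) / 2\<rfloor>"
  proof -
    have "real n * Delta X G \<Theta> h D (empirical X xs) = real l"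
      using \<Delta> assms(8) n2 by (simp add: l_def)
    then have "(real n - real n * Delta X G \<Theta> h D (empirical X xs) + 1) / 2
                 = real (n - l + 1) / real 2"
      using ln by (simp add: of_nat_diff)
    then show ?thesis
      unfolding k_def by (simp only: floor_divide_of_nat_eq of_int_of_nat_eq)
  qed
  finally show ?thesis
    using assms(8) by simp
qed

end
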